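(* Consider a Boolean control network with algebraic form $x(t+1)=Lu(t)x(t)$, $y(t)=Hx(t)$, where $x(t)\in\Delta_{2^n}$, $u(t)\in\Delta_{2^m}$, $y(t)\in\Delta_{2^p}$. Let $\Theta=\{zx : z,x\in\Delta_{2^n},\ z\neq x \text{ and } Hz=Hx\}$ and $\Xi=\{zx : z,x\in\Delta_{2^n},\ Hz\neq Hx\}$. Then the network is observable if and only if the extended system $$z(t+1)=Lu(t)z(t),\qquad x(t+1)=Lu(t)x(t)$$ (both components driven by the same control $u(t)$) is set controllable from $P^0$ to $P^d$, where $P^0=\{\{zx\} : zx\in\Theta\}$ (each single element of $\Theta$ is one initial set) and $P^d=\{\Xi\}$ (the only destination set is $\Xi$).
   Context: Boolean control network: $x_i(t+1)=f_i(x_1(t),\dots,x_n(t);u_1(t),\dots,u_m(t))$, $i=1,\dots,n$, and $y_j(t)=h_j(x_1(t),\dots,x_n(t))$, $j=1,\dots,p$, with all variables in $\mathcal D=\{0,1\}$ and $f_i:\mathcal D^{m+n}\to\mathcal D$, $h_j:\mathcal D^n\to\mathcal D$ arbitrary Boolean functions. Algebraic form: let $\delta_k^i$ be the $i$-th column of the identity matrix $I_k$ and $\Delta_k=\{\delta_k^1,\dots,\delta_k^k\}$. Identify $1\sim\delta_2^1$, $0\sim\delta_2^2$. Products of matrices and vectors are semi-tensor products: for $A$ of size $a\times b$ and $B$ of size $c\times d$, with $t=\mathrm{lcm}(b,c)$, $A\ltimes B=(A\otimes I_{t/b})(B\otimes I_{t/c})$; for column vectors this is the Kronecker product. Put $x(t)=x_1(t)\ltimes\cdots\ltimes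 x_n(t)\in\Delta_{2^n}$, $u(t)=u_1(t)\ltimes\cdots\ltimes u_m(t)\in\Delta_{2^m}$, $y(t)=y_1(t)\ltimes\cdots\ltimes y_p(t)\in\Delta_{2^p}$. The network is then equivalently written $x(t+1)=Lu(t)x(t)$, $y(t)=Hx(t)$ with unique matrices $L$ of size $2^n\times 2^{n+m}$ and $H$ of size $2^p\times 2^n$, whose columns lie in $\Delta_{2^n}$ and $\Delta_{2^p}$ respectively. Observability: the network is observable if for any two initial states $x_0\neq z_0$ in $\Delta_{2^n}$ there exist an integer $T\ge 0$ and a control sequence $u=\{u(0),\dots,u(T-1)\}$ such that the output sequence $y(0),\dots,y(T)$ obtained from $x(0)=x_0$ under $u$ is not equal to the output sequence $\tilde y(0),\dots,\tilde y(T)$ obtained from $z_0$ under the same $u$. The extended system has states the pairs $(z,x)\in\Delta_{2^n}\times\Delta_{2^n}$, equivalently the products $zx=z\ltimes x\in\Delta_{2^{2n}}$. Set controllability: for a control system of this type with finite state space, a state $w_d$ is controllable from a state $w_0$ if there are $T>0$ and controls $u(0),\dots,u(T-1)$ driving the trajectory from $w(0)=w_0$ to $w(T)=w_d$. Given a family $P^0$ of initial sets of states and a family $P^d$ of destination sets of states, the system is set controllable (from $P^0$ to $P^d$) if for every $s^0\in P^0$ and every $s^d\in P^d$ there exist $w_0\in s^0$ and $w_d\in s^d$ such that $w_d$ is controllable from $w_0$. *)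

theory Defs
  imports "Jordan_Normal_Form.Matrix"
begin

definition kron :: "real mat \<Rightarrow> real mat \<Rightarrow> real mat" where
  "kron A B = mat (dim_row A * dim_row B) (dim_col A * dim_col B)
     (\<lambda>(i, j). A $$ (i div dim_row B, j div dim_col B) * B $$ (i mod dim_row B, j mod dim_col B))"

definition stp :: "real mat \<Rightarrow> real mat \<Rightarrow> real mat" (infixl "\<ltimes>" 70) where
  "A \<ltimes> B = (let t = lcm (dim_col A) (dim_row B) in
     kron A (1\<^sub>m (t div dim_col A)) * kron B (1\<^sub>m (t div dim_row B)))"

text \<open>Vectors are one-column matrices, so that the semi-tensor product applies to them.
  The index \<open>i\<close> of \<open>delta k i\<close> is counted from 1, while library columns are counted from 0.\<close>

definition column :: "real mat \<Rightarrow> nat \<Rightarrow> real mat" where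
  "column A j = mat_of_cols (dim_row A) [col A j]"

definition delta :: "nat \<Rightarrow> nat \<Rightarrow> real mat" where
  "delta k i = column (1\<^sub>m k) (i - 1)"

definition Delta :: "nat \<Rightarrow> real mat set" where
  "Delta k = {delta k i | i. 1 \<le> i \<and> i \<le> k}"

definition logical_mats :: "nat \<Rightarrow> nat \<Rightarrow> real mat set" where
  "logical_mats r c = {A \<in> carrier_mat r c. \<forall>j<c. column A j \<in> Delta r}"

definition bool_vec :: "bool \<Rightarrow> real mat" where
  "bool_vec b = (if b then delta 2 1 else delta 2 2)"

text \<open>The product \<open>x\<^sub>1 \<ltimes> \<dots> \<ltimes> x\<^sub>n\<close> of the entries of a list;
  the trailing factor is the neutral 1 by 1 matrix.\<close>

definition bools_vec :: "bool list \<Rightarrow> real mat" where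
  "bools_vec xs = foldr (\<lambda>b v. bool_vec b \<ltimes> v) xs (1\<^sub>m 1)"

text \<open>The network has \<open>n\<close> state nodes, \<open>m\<close> inputs and \<open>p\<close> outputs. Its update functions are
  \<open>f i X U\<close> for \<open>i < n\<close> and its output functions are \<open>h j X\<close> for \<open>j < p\<close>, where \<open>X\<close> and \<open>U\<close> list
  the values of the state and input nodes; values of \<open>f\<close> and \<open>h\<close> at lists of other lengths are
  irrelevant.\<close>

definition algebraic_form ::
  "nat \<Rightarrow> nat \<Rightarrow> nat \<Rightarrow> (nat \<Rightarrow> bool list \<Rightarrow> bool list \<Rightarrow> bool) \<Rightarrow> (nat \<Rightarrow> bool list \<Rightarrow> bool)
     \<Rightarrow> real mat \<Rightarrow> real mat \<Rightarrow> bool" where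
  "algebraic_form n m p f h L H \<longleftrightarrow>
     L \<in> logical_mats (2 ^ n) (2 ^ (n + m)) \<and>
     H \<in> logical_mats (2 ^ p) (2 ^ n) \<and>
     (\<forall>X U. length X = n \<longrightarrow> length U = m \<longrightarrow>
        bools_vec (map (\<lambda>i. f i X U) [0..<n]) = L \<ltimes> bools_vec U \<ltimes> bools_vec X) \<and>
     (\<forall>X. length X = n \<longrightarrow>
        bools_vec (map (\<lambda>j. h j X) [0..<p]) = H \<ltimes> bools_vec X)"

text \<open>Control systems \<open>w(t+1) = step (u t) (w t)\<close> in general. Control sequences of length \<open>T\<close> are
  functions on the naturals of which only the values at \<open>t < T\<close> matter.\<close>

primrec trajectory :: "('u \<Rightarrow> 's \<Rightarrow> 's) \<Rightarrow> (nat \<Rightarrow> 'u) \<Rightarrow> 's \<Rightarrow> nat \<Rightarrow> 's" where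
  "trajectory step u w0 0 = w0"
| "trajectory step u w0 (Suc t) = step (u t) (trajectory step u w0 t)"

definition controllable_from :: "'u set \<Rightarrow> ('u \<Rightarrow> 's \<Rightarrow> 's) \<Rightarrow> 's \<Rightarrow> 's \<Rightarrow> bool" where
  "controllable_from Us step w0 wd \<longleftrightarrow>
     (\<exists>T>0. \<exists>u. (\<forall>t<T. u t \<in> Us) \<and> trajectory step u w0 T = wd)"

definition set_controllable ::
  "'u set \<Rightarrow> ('u \<Rightarrow> 's \<Rightarrow> 's) \<Rightarrow> 's set set \<Rightarrow> 's set set \<Rightarrow> bool" where
  "set_controllable Us step P0 Pd \<longleftrightarrow>
     (\<forall>s0\<in>P0. \<forall>sd\<in>Pd. \<exists>w0\<in>s0. \<exists>wd\<in>sd. controllable_from Us step w0 wd)"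

definition net_step :: "real mat \<Rightarrow> real mat \<Rightarrow> real mat \<Rightarrow> real mat" where
  "net_step L u x = L \<ltimes> u \<ltimes> x"

definition output_seq ::
  "real mat \<Rightarrow> real mat \<Rightarrow> (nat \<Rightarrow> real mat) \<Rightarrow> real mat \<Rightarrow> nat \<Rightarrow> real mat list" where
  "output_seq L H u x0 T = map (\<lambda>t. H \<ltimes> trajectory (net_step L) u x0 t) [0..<Suc T]"

definition observable :: "nat \<Rightarrow> nat \<Rightarrow> real mat \<Rightarrow> real mat \<Rightarrow> bool" where
  "observable n m L H \<longleftrightarrow>
     (\<forall>x0\<in>Delta (2 ^ n). \<forall>z0\<in>Delta (2 ^ n). x0 \<noteq> z0 \<longrightarrow>
        (\<exists>T u. (\<forall>t<T. u t \<in> Delta (2 ^ m)) \<and> output_seq L H u x0 T \<noteq> output_seq L H u z0 T))"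

text \<open>A state \<open>z \<ltimes> x\<close> of the extended system is represented by the pair \<open>(z, x)\<close>.\<close>

definition ext_step :: "real mat \<Rightarrow> real mat \<Rightarrow> real mat \<times> real mat \<Rightarrow> real mat \<times> real mat" where
  "ext_step L u = (\<lambda>(z, x). (L \<ltimes> u \<ltimes> z, L \<ltimes> u \<ltimes> x))"

definition Theta :: "nat \<Rightarrow> real mat \<Rightarrow> (real mat \<times> real mat) set" where
  "Theta n H = {(z, x). z \<in> Delta (2 ^ n) \<and> x \<in> Delta (2 ^ n) \<and> z \<noteq> x \<and> H \<ltimes> z = H \<ltimes> x}"

definition Xi :: "nat \<Rightarrow> real mat \<Rightarrow> (real mat \<times> real mat) set" where
  "Xi n H = {(z, x). z \<in> Delta (2 ^ n) \<and> x \<in> Delta (2 ^ n) \<and> H \<ltimes> z \<noteq> H \<ltimes> x}"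

end

theory Submission
  imports Defs
begin

text \<open>A trajectory of the extended system is the pair of network trajectories driven by one
  common control (\<open>trajectory_ext_step\<close>), so it lies in \<open>Xi n H\<close> at time t
  exactly when both components are in \<open>Delta (2 ^ n)\<close> and their outputs at t differ.
  Hence steering (z, x) into \<open>Xi n H\<close> amounts to finding a control that separates z
  from x. Distinct states with different outputs are separated at time 0; the other distinct pairs
  form \<open>Theta n H\<close>, and they can only be separated at a positive time, as
  controllability requires. What remains is that trajectories stay in \<open>Delta (2 ^ n)\<close>.
  This rests on \<open>column_stp_delta\<close>: multiplying by \<open>delta k i\<close> on the
  right selects the i-th block of consecutive columns, so logical matrices stay logical.\<close>

lemma kron_one_one: "kron A (1\<^sub>m 1) = A"
  by (rule eq_matI) (auto simp: kron_def)

text \<open>The product is a stack of k blocks of size c by c, with the identity in block i and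
  zeros elsewhere. Rows are counted from 0, so that block starts at row
  \<open>(i - 1) * c\<close>.\<close>

lemma kron_delta_one:
  assumes "1 \<le> i" "i \<le> k"
  shows "kron (delta k i) (1\<^sub>m c) =
    mat (k * c) c (\<lambda>(a, b). if a = (i - 1) * c + b then 1 else 0)"
proof (rule eq_matI)
  fix a b
  assume ab: "a < dim_row (mat (k * c) c (\<lambda>(a, b). if a = (i - 1) * c + b then 1 else 0 :: real))"
    "b < dim_col (mat (k * c) c (\<lambda>(a, b). if a = (i - 1) * c + b then 1 else 0 :: real))"
  then have "c > 0" "a < k * c" "b < c" by auto
  moreover have "a div c < k" "a mod c < c"
    using \<open>a < k * c\<close> \<open>c > 0\<close> by (simp_all add: less_mult_imp_div_less)
  moreover have "a div c = i - 1 \<and> a mod c = b \<longleftrightarrow> a = (i - 1) * c + b"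
  proof
    show "a = (i - 1) * c + b" if "a div c = i - 1 \<and> a mod c = b"
      using that div_mult_mod_eq[of a c] by metis
    show "a div c = i - 1 \<and> a mod c = b" if "a = (i - 1) * c + b"
      using that \<open>b < c\<close> by simp
  qed
  ultimately show "kron (delta k i) (1\<^sub>m c) $$ (a, b) =
    mat (k * c) c (\<lambda>(a, b). if a = (i - 1) * c + b then 1 else 0) $$ (a, b)"
    using assms by (auto simp: kron_def delta_def column_def mat_of_cols_def)
qed (auto simp: kron_def delta_def column_def mat_of_cols_def)

text \<open>As k divides \<open>k * c\<close>, the lcm is \<open>k * c\<close>: \<open>A\<close> is
  padded only by the 1 by 1 identity, and \<open>delta k i\<close> by the identity of size
  c.\<close>

lemma stp_delta_eq:
  assumes "A \<in> carrier_mat r (k * c)" "c > 0" "1 \<le> i" "i \<le> k"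
  shows "A \<ltimes> delta k i = A * mat (k * c) c (\<lambda>(a, b). if a = (i - 1) * c + b then 1 else 0)"
proof -
  have "dim_row (delta k i) = k"
    by (simp add: delta_def column_def)
  moreover have "lcm (k * c) k = k * c"
    by (simp add: lcm_proj1_if_dvd)
  moreover have "k > 0"
    using assms by linarith
  ultimately show ?thesis
    using assms kron_one_one[of A] kron_delta_one[of i k c] by (simp add: stp_def Let_def)
qed

lemma block_index_less:
  fixes c i j k :: nat
  assumes "1 \<le> i" "i \<le> k" "j < c"
  shows "(i - 1) * c + j < k * c"
proof -
  have "(i - 1) * c + j < (i - 1) * c + c"
    using assms by simp
  also have "\<dots> = i * c"
    using assms by (cases i) auto
  also have "\<dots> \<le> k * c"
    using assms by simp
  finally show ?thesis .
qed

lemma column_stp_delta: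
  assumes A: "A \<in> carrier_mat r (k * c)" and i: "1 \<le> i" "i \<le> k" and j: "j < c"
  shows "column (A \<ltimes> delta k i) j = column A ((i - 1) * c + j)"
proof -
  let ?M = "mat (k * c) c (\<lambda>(a, b). if a = (i - 1) * c + b then 1 else 0 :: real)"
  have bound: "(i - 1) * c + j < k * c"
    using block_index_less[OF i j] .
  \<comment> \<open>Each column of the selector matrix is a unit vector, so multiplying by
    \<open>A\<close> reads off a single column of \<open>A\<close>.\<close>
  have "col ?M j = unit_vec (k * c) ((i - 1) * c + j)"
    using j bound by (intro eq_vecI) auto
  moreover have "col (A * ?M) j = A *\<^sub>v col ?M j"
    using A j by (intro col_mult2) auto
  ultimately have "col (A * ?M) j = col A ((i - 1) * c + j)"
    using A bound by (auto intro!: eq_vecI simp: scalar_prod_right_unit)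
  then show ?thesis
    using A i j stp_delta_eq[OF A _ i] by (simp add: column_def)
qed

lemma stp_logical_mats:
  assumes A: "A \<in> logical_mats r (k * c)" and u: "u \<in> Delta k" and c: "c > 0"
  shows "A \<ltimes> u \<in> logical_mats r c"
proof -
  from u obtain i where i: "1 \<le> i" "i \<le> k" and [simp]: "u = delta k i"
    by (auto simp: Delta_def)
  have carrier: "A \<in> carrier_mat r (k * c)"
    using A by (simp add: logical_mats_def)
  have "column (A \<ltimes> u) j \<in> Delta r" if "j < c" for j
    using A column_stp_delta[OF carrier i that] block_index_less[OF i that]
    by (simp add: logical_mats_def)
  moreover have "A \<ltimes> u \<in> carrier_mat r c"
    using carrier c i by (auto simp: stp_delta_eq)
  ultimately show ?thesis
    by (simp add: logical_mats_def)
qed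

lemma logical_mats_single_column:
  assumes "v \<in> logical_mats r 1"
  shows "v \<in> Delta r"
proof -
  have "v \<in> carrier_mat r 1" "column v 0 \<in> Delta r"
    using assms by (auto simp: logical_mats_def)
  moreover from this have "column v 0 = v"
    by (intro eq_matI) (auto simp: column_def mat_of_cols_def)
  ultimately show ?thesis by simp
qed

text \<open>Two block selections: \<open>u\<close> picks one of the k square blocks of
  \<open>L\<close>, then \<open>x\<close> picks one column of that block (the case c = 1).\<close>

lemma net_step_in_Delta:
  assumes "L \<in> logical_mats r (k * r)" "u \<in> Delta k" "x \<in> Delta r"
  shows "net_step L u x \<in> Delta r"
proof -
  have "r > 0"
    using assms(3) by (auto simp: Delta_def)
  then have "L \<ltimes> u \<in> logical_mats r (r * 1)"
    using stp_logical_mats assms by simp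
  then show ?thesis
    unfolding net_step_def
    using stp_logical_mats[of _ r r 1 x] assms(3) logical_mats_single_column by simp
qed

lemma trajectory_net_step_in_Delta:
  assumes "L \<in> logical_mats r (k * r)" "x \<in> Delta r" "\<forall>s<t. u s \<in> Delta k"
  shows "trajectory (net_step L) u x t \<in> Delta r"
  using assms(3) by (induction t) (simp_all add: assms(2) net_step_in_Delta[OF assms(1)])

lemma trajectory_ext_step:
  "trajectory (ext_step L) u (z, x) t =
    (trajectory (net_step L) u z t, trajectory (net_step L) u x t)"
  by (induction t) (auto simp: ext_step_def net_step_def)

lemma output_seq_eq_iff:
  "output_seq L H u x T = output_seq L H u z T \<longleftrightarrow>
    (\<forall>t\<le>T. H \<ltimes> trajectory (net_step L) u x t = H \<ltimes> trajectory (net_step L) u z t)"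
  by (auto simp: output_seq_def less_Suc_eq_le simp del: upt_Suc)

theorem mainTheorem2:
  fixes n m p :: nat
    and f :: "nat \<Rightarrow> bool list \<Rightarrow> bool list \<Rightarrow> bool"
    and h :: "nat \<Rightarrow> bool list \<Rightarrow> bool"
    and L H :: "real mat"
  assumes "algebraic_form n m p f h L H"
  shows "observable n m L H \<longleftrightarrow>
    set_controllable (Delta (2 ^ m)) (ext_step L) {{w} | w. w \<in> Theta n H} {Xi n H}"
proof
  \<comment> \<open>The column count is factored with the control first, because \<open>u\<close> is
    multiplied onto \<open>L\<close> before the state.\<close>
  have L: "L \<in> logical_mats (2 ^ n) (2 ^ m * 2 ^ n)"
    using assms by (simp add: algebraic_form_def power_add mult.commute)
  assume obs: "observable n m L H"
  have "\<exists>wd\<in>Xi n H. controllable_from (Delta (2 ^ m)) (ext_step L) (z, x) wd"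
    if zx: "(z, x) \<in> Theta n H" for z x
  proof -
    have D: "z \<in> Delta (2 ^ n)" "x \<in> Delta (2 ^ n)" and "z \<noteq> x" and eq: "H \<ltimes> z = H \<ltimes> x"
      using zx by (auto simp: Theta_def)
    then obtain T u where u: "\<forall>t<T. u t \<in> Delta (2 ^ m)"
      and "output_seq L H u z T \<noteq> output_seq L H u x T"
      using obs unfolding observable_def by blast
    then obtain t where t: "t \<le> T" and
      ne: "H \<ltimes> trajectory (net_step L) u z t \<noteq> H \<ltimes> trajectory (net_step L) u x t"
      by (auto simp: output_seq_eq_iff)
    have ut: "\<forall>s<t. u s \<in> Delta (2 ^ m)"
      using u t by auto
    \<comment> \<open>At time 0 the outputs agree by membership in \<open>Theta n H\<close>, so the
      separating time is positive.\<close>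
    have "t > 0"
      using ne eq by (cases t) auto
    moreover have "trajectory (ext_step L) u (z, x) t \<in> Xi n H"
      using ne trajectory_net_step_in_Delta[OF L _ ut] D
      by (simp add: trajectory_ext_step Xi_def)
    ultimately show ?thesis
      using ut unfolding controllable_from_def by blast
  qed
  then show "set_controllable (Delta (2 ^ m)) (ext_step L) {{w} | w. w \<in> Theta n H} {Xi n H}"
    by (auto simp: set_controllable_def)
next
  assume sc: "set_controllable (Delta (2 ^ m)) (ext_step L) {{w} | w. w \<in> Theta n H} {Xi n H}"
  show "observable n m L H"
    unfolding observable_def
  proof (intro ballI impI)
    fix z x assume D: "z \<in> Delta (2 ^ n)" "x \<in> Delta (2 ^ n)" and "z \<noteq> x"
    show "\<exists>T u. (\<forall>t<T. u t \<in> Delta (2 ^ m)) \<and> output_seq L H u z T \<noteq> output_seq L H u x T"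
    proof (cases "H \<ltimes> z = H \<ltimes> x")
      case True
      then have "{(z, x)} \<in> {{w} | w. w \<in> Theta n H}"
        using D \<open>z \<noteq> x\<close> by (simp add: Theta_def)
      then have "\<exists>w\<in>{(z, x)}. \<exists>wd\<in>Xi n H. controllable_from (Delta (2 ^ m)) (ext_step L) w wd"
        using sc unfolding set_controllable_def by (metis (no_types, lifting) insertI1)
      then obtain T u where "\<forall>t<T. u t \<in> Delta (2 ^ m)"
        and "trajectory (ext_step L) u (z, x) T \<in> Xi n H"
        unfolding controllable_from_def by blast
      \<comment> \<open>The outputs differ at the final time \<open>T\<close>, the last entry of the
        output sequences.\<close>
      then show ?thesis
        unfolding output_seq_eq_iff by (auto simp: trajectory_ext_step Xi_def)
    next
      case False
      \<comment> \<open>The horizon is 0: the initial outputs already differ, and the constraint on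
        the control is vacuous.\<close>
      then have "output_seq L H u z 0 \<noteq> output_seq L H u x 0" for u
        by (simp add: output_seq_eq_iff)
      then show ?thesis by blast
    qed
  qed
qed

end
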